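(* Let $\Omega\subset\mathbb{R}^3$ be an open bounded domain with polytopal boundary and let $\mathcal{T}$ be a conforming simplicial (tetrahedral) mesh of $\overline\Omega$ with vertices $v_1,\dots,v_V$, with mean solid angles $\overline{\alpha}_i$ and minimal solid angles $\alpha_i,\alpha_{\mathcal{T}}\in(0,2\pi)$, $i=1,\dots,V$ (as defined in the context). Then, for any interior vertex $v_i$ of $\mathcal{T}$, the number $e_i$ of edges of $\mathcal{T}$ intersecting at $v_i$ satisfies $$e_i = 2+\frac{2\pi}{\overline{\alpha}_i}\leq 2+\frac{2\pi}{\alpha_i}\leq 2+\frac{2\pi}{\alpha_{\mathcal{T}}}.$$
   Context: A conforming tetrahedral mesh of $\overline\Omega$ is a finite set of closed non-degenerate tetrahedra whose union is $\overline\Omega$ and such that any two distinct tetrahedra intersect in the empty set, a common vertex, a common edge or a common (triangular) face. A vertex is interior if it does not lie on $\partial\Omega$. For a vertex $v_i$ let $\omega(v_i)=\{\tau\in\mathcal{T}: v_i\in\tau\}$ be its star and $t_i$ the number of tetrahedra in $\omega(v_i)$. For $\tau\in\omega(v_i)$ let $\alpha_{\tau,i}\in(0,2\pi)$ be the solid angle of $\tau$ with apex $v_i$. Define $$\overline{\alpha}_i=\frac{1}{t_i}\sum_{\tau\in\omega(v_i)}\alpha_{\tau,i},\qquad \alpha_i=\min_{\tau\in\omega(v_i)}\alpha_{\tau,i},\qquad \alpha_{\mathcal{T}}=\min_{i=1,\dots,V}\alpha_i.$$ *)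

theory Defs
  imports "HOL-Analysis.Analysis"
begin

definition polytopal_domain :: "(real^3) set \<Rightarrow> bool" where
  "polytopal_domain \<Omega> \<longleftrightarrow>
     open \<Omega> \<and> connected \<Omega> \<and> \<Omega> \<noteq> {} \<and> bounded \<Omega> \<and>
     (\<exists>\<F>. finite \<F> \<and> (\<forall>P\<in>\<F>. polytope P \<and> aff_dim P = 2) \<and> frontier \<Omega> = \<Union>\<F>)"

definition conforming_tet_mesh :: "(real^3) set set \<Rightarrow> (real^3) set \<Rightarrow> bool" where
  "conforming_tet_mesh \<T> D \<longleftrightarrow>
     finite \<T> \<and> (\<forall>\<tau>\<in>\<T>. 3 simplex \<tau>) \<and> \<Union>\<T> = D \<and>
     (\<forall>\<tau>\<in>\<T>. \<forall>\<tau>'\<in>\<T>. \<tau> \<noteq> \<tau>' \<longrightarrow>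
        \<tau> \<inter> \<tau>' = {} \<or>
        (\<tau> \<inter> \<tau>' face_of \<tau> \<and> \<tau> \<inter> \<tau>' face_of \<tau>' \<and> aff_dim (\<tau> \<inter> \<tau>') \<in> {0, 1, 2}))"

definition mesh_vertices :: "(real^3) set set \<Rightarrow> (real^3) set" where
  "mesh_vertices \<T> = {v. \<exists>\<tau>\<in>\<T>. v extreme_point_of \<tau>}"

definition mesh_edges :: "(real^3) set set \<Rightarrow> (real^3) set set" where
  "mesh_edges \<T> = {e. \<exists>\<tau>\<in>\<T>. e edge_of \<tau>}"

definition edges_at :: "(real^3) set set \<Rightarrow> real^3 \<Rightarrow> (real^3) set set" where
  "edges_at \<T> v = {e \<in> mesh_edges \<T>. v \<in> e}"

definition star :: "(real^3) set set \<Rightarrow> real^3 \<Rightarrow> (real^3) set set" where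
  "star \<T> v = {\<tau> \<in> \<T>. v \<in> \<tau>}"

text \<open>
  Surface area of a part A of the unit sphere, as the cone measure: in polar coordinates the
  cone over A inside the unit ball has volume area(A) times the integral of r^2 over [0, 1],
  that is area(A) / 3.
\<close>
definition sphere_area :: "(real^3) set \<Rightarrow> real" where
  "sphere_area A = 3 * measure lebesgue {r *\<^sub>R u | r u. 0 \<le> r \<and> r \<le> 1 \<and> u \<in> A}"

lemma sphere_area_sphere: "sphere_area (sphere 0 1) = 4 * pi"
proof -
  have "{r *\<^sub>R u | r u. 0 \<le> r \<and> r \<le> 1 \<and> u \<in> sphere (0::real^3) 1} = cball 0 1" (is "?C = _")
  proof (intro equalityI subsetI)
    fix x :: "real^3" assume "x \<in> cball 0 1"
    show "x \<in> ?C"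
    proof (cases "x = 0")
      case True
      have "x = 0 *\<^sub>R axis 1 1" "axis 1 1 \<in> sphere (0::real^3) 1"
        using True by (simp_all add: norm_axis_1)
      then show ?thesis by (metis (mono_tags, lifting) mem_Collect_eq order_refl zero_le_one)
    next
      case False
      then have "x = norm x *\<^sub>R sgn x" "sgn x \<in> sphere 0 1"
        by (simp_all add: sgn_div_norm norm_sgn)
      then show ?thesis using \<open>x \<in> cball 0 1\<close> by (auto intro!: exI[of _ "norm x"] exI[of _ "sgn x"])
    qed
  qed (auto simp: dist_norm)
  then show ?thesis
    by (simp add: sphere_area_def content_cball unit_ball_vol_3)
qed

text \<open>
  The solid angle with apex v is the area of the radial projection from v onto the unit sphere;
  \<open>sgn x\<close> is the unit vector in direction x.
\<close>
definition solid_angle :: "(real^3) set \<Rightarrow> real^3 \<Rightarrow> real" where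
  "solid_angle \<tau> v = sphere_area ((\<lambda>x. sgn (x - v)) ` (\<tau> - {v}))"

definition mean_solid_angle :: "(real^3) set set \<Rightarrow> real^3 \<Rightarrow> real" where
  "mean_solid_angle \<T> v = (\<Sum>\<tau>\<in>star \<T> v. solid_angle \<tau> v) / real (card (star \<T> v))"

definition min_solid_angle :: "(real^3) set set \<Rightarrow> real^3 \<Rightarrow> real" where
  "min_solid_angle \<T> v = Min ((\<lambda>\<tau>. solid_angle \<tau> v) ` star \<T> v)"

definition mesh_min_solid_angle :: "(real^3) set set \<Rightarrow> real" where
  "mesh_min_solid_angle \<T> = Min (min_solid_angle \<T> ` mesh_vertices \<T>)"

end

theory Submission
  imports Defs
begin

text \<open>
  The identity comes from computing one sum of volumes in two ways. Translate \<open>v\<close> to the origin.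
  Each of the \<open>t\<close> tetrahedra at \<open>v\<close> spans a simplicial cone whose generators are the vectors along
  its three edges at \<open>v\<close>, and since \<open>v\<close> is interior these cones tile the whole space. Let \<open>B\<close> be the
  volume of the unit ball, and measure a cone by the volume of its part in this ball, which is
  a third of its solid angle. The tiling gives \<open>B\<close> as the sum of the cone volumes, so that the
  solid angles sum to \<open>4 * pi\<close> and \<open>2 * pi\<close> over their mean is \<open>t / 2\<close>. It remains to see that the
  number of edges is \<open>2 + t / 2\<close>, which is Euler's formula for the triangulated sphere around \<open>v\<close>.

  For a cone \<open>C\<close> and a generator \<open>a\<close> of it, the wedge of \<open>C\<close> at \<open>a\<close> is the intersection of the two
  half-spaces bounded by the facets through \<open>a\<close>; its volume stands for the dihedral angle at \<open>a\<close>.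
  Two facts about wedges suffice.

  \<^item> Girard's theorem (\<open>sum_wedges\<close>): the three wedges of \<open>C\<close> have total volume
    \<open>2 * vol C + B / 2\<close>. This is inclusion-exclusion for three half-balls, because the
    complement of their union is, up to a null set, the reflection of their intersection.
  \<^item> For a fixed edge vector \<open>a\<close> the wedges at \<open>a\<close> tile the space
    (\<open>sum_wedges_around_generator\<close>): wedges at \<open>a\<close> are invariant under translation along
    \<open>a\<close>, and a point of the wedge that is moved far enough in the direction of \<open>a\<close> enters the cone,
    so the tiling by cones carries over. Hence these wedges have total volume \<open>B\<close>.

  With \<open>e\<close> edges at \<open>v\<close>, summing the volumes of all wedges by edges gives \<open>e * B\<close>, and by cones
  \<open>2 * B + t * B / 2\<close>; hence \<open>e = 2 + t / 2\<close> (\<open>card_generators\<close>). The remaining lemmas show that an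
  interior vertex of a conforming mesh yields such a tiling by cones and match solid angles with
  cone volumes and mesh edges with generators.
\<close>

section \<open>Half-balls\<close>

definition halfball :: "'a::euclidean_space \<Rightarrow> 'a set" where
  "halfball a = {x \<in> cball 0 1. 0 \<le> a \<bullet> x}"

lemma halfball_subset: "halfball a \<subseteq> cball 0 1"
  by (auto simp: halfball_def)

lemma lmeasurable_halfball [simp]: "halfball a \<in> lmeasurable"
proof -
  have "halfball a = cball 0 1 \<inter> {x. a \<bullet> x \<ge> 0}" by (auto simp: halfball_def)
  then show ?thesis by (metis compact_Int_closed compact_cball closed_halfspace_ge lmeasurable_compact)
qed

text \<open>
  The reflection \<open>x \<mapsto> - x\<close> maps the points of the unit ball outside all half-balls to those strictly
  inside all of them, and the boundary hyperplanes are null sets. For a singleton this says that a half-ball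
  has half the volume.
\<close>
lemma measure_antipodal_halfballs:
  fixes U :: "(real^'n::{finite,wellorder}) set"
  assumes "finite U" "0 \<notin> U"
  shows "measure lebesgue (cball 0 1 - \<Union>(halfball ` U)) =
         measure lebesgue (cball 0 1 \<inter> \<Inter>(halfball ` U))"
proof -
  let ?N = "cball 0 1 - \<Union>(halfball ` U)" and ?P = "cball 0 1 \<inter> \<Inter>(halfball ` U)"
  have N: "?N \<in> lmeasurable"
    using assms by (intro fmeasurable.Diff fmeasurable.finite_UN) auto
  have refl: "uminus ` ?N = {x \<in> cball 0 1. \<forall>u\<in>U. 0 < u \<bullet> x}" (is "?L = ?R")
  proof (intro equalityI subsetI)
    fix x assume "x \<in> ?R"
    then have "- x \<in> ?N" by (force simp: halfball_def)
    then show "x \<in> ?L" by (metis image_eqI minus_minus)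
  qed (force simp: halfball_def not_le)
  have "uminus ` ?N - ?P \<union> (?P - uminus ` ?N) \<subseteq> (\<Union>u\<in>U. {x. u \<bullet> x = 0})"
    unfolding refl by (force simp: halfball_def)
  moreover have "negligible (\<Union>u\<in>U. {x. u \<bullet> x = 0})"
    using assms by (intro negligible_Union) (auto intro!: negligible_hyperplane)
  moreover have ortho: "orthogonal_transformation (uminus :: real^'n::{finite,wellorder} \<Rightarrow> _)"
    by (simp add: orthogonal_transformation_def linear_uminus)
  moreover have "uminus ` ?N \<in> lmeasurable"
    using measurable_linear_image[OF linear_uminus N] .
  ultimately have "measure lebesgue ?P = measure lebesgue (uminus ` ?N)"
    by (intro measure_negligible_symdiff) (auto intro: negligible_subset)
  then show ?thesis
    using measure_orthogonal_image[OF ortho N] by simp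
qed

text \<open>
  Inclusion-exclusion for the union of the half-balls, whose complement in the ball has the volume
  of the triple intersection by antipodal symmetry. When the three half-spaces cut out a
  simplicial cone, the double intersections are its wedges, and this is Girard's theorem.
\<close>
lemma three_halfballs:
  fixes a b c :: "real^'n::{finite,wellorder}"
  assumes "a \<noteq> 0" "b \<noteq> 0" "c \<noteq> 0"
  shows "measure lebesgue (halfball b \<inter> halfball c) + measure lebesgue (halfball a \<inter> halfball c) +
           measure lebesgue (halfball a \<inter> halfball b) =
         2 * measure lebesgue (halfball a \<inter> halfball b \<inter> halfball c) +
           measure lebesgue (cball (0::real^'n::{finite,wellorder}) 1) / 2"
proof -
  let ?B = "cball (0::real^'n::{finite,wellorder}) 1"
  have half: "measure lebesgue (halfball u) = measure lebesgue ?B / 2" if "u \<noteq> 0" for u :: "real^'n::{finite,wellorder}"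
    using measure_antipodal_halfballs[of "{u}"] that halfball_subset[of u]
      measurable_measure_Diff[of ?B lebesgue "halfball u"]
    by (simp add: Int_absorb1 Int_absorb2 fmeasurableD)
  let ?U = "halfball a \<union> (halfball b \<union> halfball c)"
  have "?U \<in> sets lebesgue" by (intro sets.Un fmeasurableD lmeasurable_halfball)
  then have "measure lebesgue ?B - measure lebesgue ?U = measure lebesgue (?B - ?U)"
    using halfball_subset by (intro measurable_measure_Diff[symmetric]) auto
  also have "\<dots> = measure lebesgue (?B \<inter> (halfball a \<inter> halfball b \<inter> halfball c))"
    using measure_antipodal_halfballs[of "{a,b,c}"] assms by (simp add: Int_assoc)
  also have "?B \<inter> (halfball a \<inter> halfball b \<inter> halfball c) = halfball a \<inter> halfball b \<inter> halfball c"
    using halfball_subset by blast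
  finally have outside: "measure lebesgue ?B - measure lebesgue ?U =
      measure lebesgue (halfball a \<inter> halfball b \<inter> halfball c)" .
  have "measure lebesgue ?U = measure lebesgue (halfball a) + measure lebesgue (halfball b) +
      measure lebesgue (halfball c) - measure lebesgue (halfball b \<inter> halfball c) -
      (measure lebesgue (halfball a \<inter> halfball b) + measure lebesgue (halfball a \<inter> halfball c) -
       measure lebesgue (halfball a \<inter> halfball b \<inter> (halfball a \<inter> halfball c)))"
    by (simp add: measure_Un3 Int_Un_distrib fmeasurable.Un fmeasurable.Int)
  also have "halfball a \<inter> halfball b \<inter> (halfball a \<inter> halfball c) = halfball a \<inter> halfball b \<inter> halfball c"
    by blast
  finally show ?thesis
    using outside half[OF assms(1)] half[OF assms(2)] half[OF assms(3)] by linarith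
qed

section \<open>Simplicial cones and their wedges\<close>

definition simplicial_cone :: "'a::real_vector set \<Rightarrow> 'a set" where
  "simplicial_cone S = {x. \<forall>s\<in>S. 0 \<le> representation S x s}"

text \<open>
  The sign condition is dropped for the coordinate along \<open>a\<close>. For three generators this is the region between the two
  half-planes that are bounded by the line through \<open>a\<close> and contain the other generators.
\<close>
definition wedge :: "'a::real_vector set \<Rightarrow> 'a \<Rightarrow> 'a set" where
  "wedge S a = {x. \<forall>s\<in>S - {a}. 0 \<le> representation S x s}"

lemma span_three_independent:
  fixes S :: "(real^3) set"
  assumes "independent S" "card S = 3"
  shows "span S = UNIV"
  using card_ge_dim_independent[of S UNIV] assms by auto

lemma ex_coordinate_vectors:
  fixes S :: "'a::euclidean_space set"
  assumes "independent S" "span S = UNIV"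
  shows "\<exists>n. \<forall>s\<in>S. n s \<noteq> 0 \<and> (\<forall>x. representation S x s = n s \<bullet> x)"
proof (intro bchoice ballI)
  fix s assume s: "s \<in> S"
  let ?f = "\<lambda>x. representation S x s"
  have lin: "linear ?f"
    by (rule linearI) (use assms in \<open>auto simp: representation_add representation_scale\<close>)
  have "?f x = adjoint ?f 1 \<bullet> x" for x
    using adjoint_works[OF lin, of x 1] by (simp add: inner_commute)
  moreover have "?f s = 1" using assms s by (simp add: representation_basis)
  ultimately show "\<exists>u. u \<noteq> 0 \<and> (\<forall>x. ?f x = u \<bullet> x)"
    by (metis inner_zero_left zero_neq_one)
qed

lemma closed_wedge:
  fixes S :: "'a::euclidean_space set"
  assumes "independent S" "span S = UNIV"
  shows "closed (wedge S a)"
proof -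
  obtain n where n: "\<forall>s\<in>S. n s \<noteq> 0 \<and> (\<forall>x. representation S x s = n s \<bullet> x)"
    using ex_coordinate_vectors[OF assms] ..
  then have "wedge S a = (\<Inter>s\<in>S - {a}. {x. n s \<bullet> x \<ge> 0})"
    by (auto simp: wedge_def)
  then show ?thesis by (auto intro: closed_halfspace_ge)
qed

text \<open>
  Dropping the condition for a vector outside \<open>S\<close> changes nothing, and \<open>0\<close> is never in an independent
  set. Topological facts about wedges thereby also cover cones.
\<close>
lemma simplicial_cone_eq_wedge_0:
  assumes "independent S"
  shows "simplicial_cone S = wedge S 0"
  using assms dependent_zero by (auto simp: simplicial_cone_def wedge_def)

text \<open>
  Girard's theorem for a trihedral cone, with volumes in the unit ball in place of angles.
\<close>
lemma sum_wedges:
  fixes S :: "(real^3) set"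
  assumes "independent S" "card S = 3"
  shows "(\<Sum>a\<in>S. measure lebesgue (wedge S a \<inter> cball 0 1)) =
         2 * measure lebesgue (simplicial_cone S \<inter> cball 0 1) +
           measure lebesgue (cball (0::real^3) 1) / 2"
proof -
  obtain n where n: "\<And>s. s \<in> S \<Longrightarrow> n s \<noteq> 0"
      "\<And>s x. s \<in> S \<Longrightarrow> representation S x s = n s \<bullet> x"
    using ex_coordinate_vectors[OF assms(1) span_three_independent[OF assms]] by blast
  obtain a b c where S: "S = {a, b, c}" and ne: "a \<noteq> b" "a \<noteq> c" "b \<noteq> c"
    using assms(2) by (metis card_3_iff)
  have abc: "a \<in> S" "b \<in> S" "c \<in> S" by (auto simp: S)
  have others: "S - {a} = {b, c}" "S - {b} = {a, c}" "S - {c} = {a, b}"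
    using ne by (auto simp: S)
  have wedges: "wedge S a \<inter> cball 0 1 = halfball (n b) \<inter> halfball (n c)"
    "wedge S b \<inter> cball 0 1 = halfball (n a) \<inter> halfball (n c)"
    "wedge S c \<inter> cball 0 1 = halfball (n a) \<inter> halfball (n b)"
    by (auto simp: wedge_def halfball_def others n(2) abc)
  have "simplicial_cone S = {x. \<forall>s\<in>{a, b, c}. 0 \<le> n s \<bullet> x}"
    using n(2) S by (auto simp: simplicial_cone_def)
  then have cone: "simplicial_cone S \<inter> cball 0 1 = halfball (n a) \<inter> halfball (n b) \<inter> halfball (n c)"
    by (auto simp: halfball_def)
  have "(\<Sum>s\<in>S. measure lebesgue (wedge S s \<inter> cball 0 1)) =
      measure lebesgue (wedge S a \<inter> cball 0 1) + measure lebesgue (wedge S b \<inter> cball 0 1) +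
      measure lebesgue (wedge S c \<inter> cball 0 1)"
    by (rule trans[OF arg_cong[OF S, of "sum _"]]) (simp add: ne)
  then show ?thesis
    using three_halfballs[of "n a" "n b" "n c"] n(1) abc unfolding wedges cone by simp
qed

section \<open>Counting the generators of a complete fan\<close>

text \<open>
  The fan is given by an indexed family of bases. Cones with different indices overlap in a null
  set, so repeated bases cannot occur and \<open>card I\<close> counts the cones. The last assumption is what
  remains of the requirement that two cones meet in a common face: a generator of one cone lies
  in another one only as a generator.
\<close>
locale complete_simplicial_fan =
  fixes I :: "'i set" and S :: "'i \<Rightarrow> (real^3) set"
  assumes finite_I: "finite I"
    and independent: "i \<in> I \<Longrightarrow> independent (S i)"
    and card_S: "i \<in> I \<Longrightarrow> card (S i) = 3"
    and cover: "(\<Union>i\<in>I. simplicial_cone (S i)) = UNIV"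
    and negligible_Int: "i \<in> I \<Longrightarrow> j \<in> I \<Longrightarrow> i \<noteq> j \<Longrightarrow>
           negligible (simplicial_cone (S i) \<inter> simplicial_cone (S j))"
    and generator: "i \<in> I \<Longrightarrow> j \<in> I \<Longrightarrow> a \<in> S i \<Longrightarrow> a \<in> simplicial_cone (S j) \<Longrightarrow> a \<in> S j"
begin

lemma span_S: "i \<in> I \<Longrightarrow> span (S i) = UNIV"
  using span_three_independent independent card_S by blast

lemma wedge_measurable: "i \<in> I \<Longrightarrow> wedge (S i) a \<inter> cball 0 1 \<in> lmeasurable"
  by (simp add: closed_wedge independent span_S lmeasurable_compact closed_Int_compact)

lemma sum_cones:
  "(\<Sum>i\<in>I. measure lebesgue (simplicial_cone (S i) \<inter> cball 0 1)) =
     measure lebesgue (cball (0::real^3) 1)"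
proof -
  have "(\<Union>i\<in>I. simplicial_cone (S i) \<inter> cball 0 1) = cball 0 1"
    using cover by blast
  moreover have "pairwise (\<lambda>i j. negligible ((simplicial_cone (S i) \<inter> cball 0 1) \<inter>
      (simplicial_cone (S j) \<inter> cball 0 1))) I"
    unfolding pairwise_def by (blast intro: negligible_subset[OF negligible_Int])
  ultimately show ?thesis
    using measure_negligible_finite_Union_image[OF finite_I,
        of "\<lambda>i. simplicial_cone (S i) \<inter> cball 0 1"] wedge_measurable[of _ 0]
    by (simp add: simplicial_cone_eq_wedge_0 independent)
qed

lemma representation_shift:
  assumes "i \<in> I" "a \<in> S i"
  shows "representation (S i) (x + t *\<^sub>R a) s = representation (S i) x s + (if s = a then t else 0)"
  using assms independent span_S
  by (simp add: representation_add representation_scale representation_basis)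

text \<open>
  If \<open>x\<close> lies in both wedges, then moving \<open>x\<close> far enough along \<open>a\<close> makes the only unconstrained
  coordinate nonnegative in both bases. So the overlap of the wedges is covered by countably many
  translates of the null set where the two cones meet.
\<close>
lemma wedges_around_generator_disjoint:
  assumes ij: "i \<in> I" "j \<in> I" "i \<noteq> j" and a: "a \<in> S i" "a \<in> S j"
  shows "negligible (wedge (S i) a \<inter> wedge (S j) a)"
proof (rule negligible_subset)
  let ?K = "simplicial_cone (S i) \<inter> simplicial_cone (S j)"
  show "negligible (\<Union>n. (+) (- real n *\<^sub>R a) ` ?K)"
    by (intro negligible_Union_nat negligible_translation negligible_Int ij)
  show "wedge (S i) a \<inter> wedge (S j) a \<subseteq> (\<Union>n. (+) (- real n *\<^sub>R a) ` ?K)"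
  proof
    fix x assume x: "x \<in> wedge (S i) a \<inter> wedge (S j) a"
    obtain n where n: "real n \<ge> - representation (S i) x a" "real n \<ge> - representation (S j) x a"
      using real_arch_simple[of "max (- representation (S i) x a) (- representation (S j) x a)"]
      by auto
    then have "x + real n *\<^sub>R a \<in> ?K"
      using x ij a by (auto simp: simplicial_cone_def wedge_def representation_shift)
    then show "x \<in> (\<Union>n. (+) (- real n *\<^sub>R a) ` ?K)"
      by (auto intro!: exI[of _ n] image_eqI[where x = "x + real n *\<^sub>R a"])
  qed
qed

text \<open>
  The points \<open>x + n * a\<close> for natural \<open>n\<close> lie in finitely many cones, so one cone contains infinitely
  many of them. That cone must contain the limiting direction \<open>a\<close>, hence has \<open>a\<close> as a generator;
  its other coordinates do not change along the sequence, so \<open>x\<close> lies in its wedge at \<open>a\<close>.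
\<close>
lemma wedges_around_generator_cover:
  assumes a: "a \<in> (\<Union>i\<in>I. S i)"
  shows "(\<Union>i\<in>{i\<in>I. a \<in> S i}. wedge (S i) a) = UNIV"
proof -
  have "\<exists>i\<in>I. a \<in> S i \<and> x \<in> wedge (S i) a" for x
  proof -
    have "\<exists>i\<in>I. x + real n *\<^sub>R a \<in> simplicial_cone (S i)" for n
      using cover by blast
    then obtain f where f: "\<And>n. f n \<in> I" "\<And>n. x + real n *\<^sub>R a \<in> simplicial_cone (S (f n))"
      by metis
    obtain i where i: "i \<in> I" and inf: "infinite {n. f n = i}"
      using pigeonhole_infinite[of UNIV f] f(1) finite_subset[OF _ finite_I]
      by (metis (mono_tags, lifting) UNIV_I infinite_UNIV_nat image_subsetI Collect_cong)
    have nonneg: "0 \<le> representation (S i) x s + real n * representation (S i) a s"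
      if "f n = i" "s \<in> S i" for n s
      using f(2)[of n] that i independent span_S
      by (simp add: simplicial_cone_def representation_add representation_scale)
    have "a \<in> simplicial_cone (S i)"
      unfolding simplicial_cone_def mem_Collect_eq
    proof (intro ballI, rule ccontr)
      fix s assume s: "s \<in> S i" and neg: "\<not> 0 \<le> representation (S i) a s"
      obtain N where N: "representation (S i) x s < real N * (- representation (S i) a s)"
        using reals_Archimedean3[of "- representation (S i) a s"] neg by auto
      obtain n where n: "f n = i" "n \<ge> N"
        using inf by (metis (mono_tags) infinite_nat_iff_unbounded_le mem_Collect_eq)
      then have "real N * (- representation (S i) a s) \<le> real n * (- representation (S i) a s)"
        using neg by (intro mult_right_mono) auto
      then show False using nonneg[OF n(1) s] N by simp
    qed
    then have "a \<in> S i" using a i generator by blast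
    moreover have "x \<in> wedge (S i) a"
    proof -
      obtain n where n: "f n = i" using inf by (metis (mono_tags) not_finite_existsD)
      have "0 \<le> representation (S i) x s" if "s \<in> S i - {a}" for s
        using nonneg[OF n, of s] that i \<open>a \<in> S i\<close> independent
        by (simp add: representation_basis)
      then show ?thesis by (simp add: wedge_def)
    qed
    ultimately show ?thesis using i by blast
  qed
  then show ?thesis by blast
qed

lemma sum_wedges_around_generator:
  assumes a: "a \<in> (\<Union>i\<in>I. S i)"
  shows "(\<Sum>i\<in>{i\<in>I. a \<in> S i}. measure lebesgue (wedge (S i) a \<inter> cball 0 1)) =
         measure lebesgue (cball (0::real^3) 1)"
proof -
  let ?J = "{i\<in>I. a \<in> S i}"
  have "(\<Union>i\<in>?J. wedge (S i) a \<inter> cball 0 1) = cball 0 1"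
    using wedges_around_generator_cover[OF a] by blast
  moreover have "pairwise (\<lambda>i j. negligible ((wedge (S i) a \<inter> cball 0 1) \<inter>
      (wedge (S j) a \<inter> cball 0 1))) ?J"
    unfolding pairwise_def by (blast intro: negligible_subset[OF wedges_around_generator_disjoint])
  ultimately show ?thesis
    using measure_negligible_finite_Union_image[of ?J "\<lambda>i. wedge (S i) a \<inter> cball 0 1"]
      wedge_measurable finite_I by simp
qed

text \<open>
  Double counting of the wedge volumes over the pairs of a cone and one of its generators.
\<close>
theorem card_generators: "real (card (\<Union>i\<in>I. S i)) = 2 + real (card I) / 2"
proof -
  let ?E = "\<Union>i\<in>I. S i" and ?B = "measure lebesgue (cball (0::real^3) 1)"
  let ?w = "\<lambda>i a. measure lebesgue (wedge (S i) a \<inter> cball 0 1)"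
  have fin: "finite (S i)" if "i \<in> I" for i
    using card_S[OF that] by (simp add: card_ge_0_finite)
  have "real (card ?E) * ?B = (\<Sum>a\<in>?E. \<Sum>i\<in>{i\<in>I. a \<in> S i}. ?w i a)"
    using sum_wedges_around_generator by simp
  also have "\<dots> = (\<Sum>i\<in>I. \<Sum>a\<in>{a\<in>?E. a \<in> S i}. ?w i a)"
    using finite_I fin by (intro sum.swap_restrict) auto
  also have "\<dots> = (\<Sum>i\<in>I. \<Sum>a\<in>S i. ?w i a)"
    by (intro sum.cong refl) auto
  also have "\<dots> = (\<Sum>i\<in>I. 2 * measure lebesgue (simplicial_cone (S i) \<inter> cball 0 1) + ?B / 2)"
    by (intro sum.cong refl sum_wedges independent card_S)
  also have "\<dots> = 2 * ?B + real (card I) * (?B / 2)"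
    using sum_cones by (simp add: sum.distrib flip: sum_distrib_left)
  also have "\<dots> = (2 + real (card I) / 2) * ?B"
    by (simp add: field_simps)
  finally show ?thesis
    using content_cball_pos[of 1 "0::real^3"] by simp
qed

end

section \<open>The cone of a tetrahedron at a vertex\<close>

definition edge_vectors :: "'a::real_vector set \<Rightarrow> 'a \<Rightarrow> 'a set" where
  "edge_vectors \<tau> v = {w - v | w. w extreme_point_of \<tau> \<and> w \<noteq> v}"

text \<open>
  In the coordinates of its edge vectors at \<open>v\<close>, a tetrahedron is the standard simplex. Near \<open>v\<close> only
  the nonnegativity conditions matter, so there the tetrahedron agrees with its cone.
\<close>
lemma simplex_in_edge_coordinates:
  fixes \<tau> :: "(real^3) set"
  assumes "3 simplex \<tau>" "v extreme_point_of \<tau>"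
  defines "S \<equiv> edge_vectors \<tau> v"
  shows "independent S" "card S = 3"
    "\<tau> = (+) v ` {y \<in> simplicial_cone S. (\<Sum>s\<in>S. representation S y s) \<le> 1}"
proof -
  obtain C where C: "\<not> affine_dependent C" "card C = 4" and \<tau>: "\<tau> = convex hull C"
    using assms(1) by (auto simp: simplex_def)
  have vertex: "w extreme_point_of \<tau> \<longleftrightarrow> w \<in> C" for w
    unfolding \<tau> by (rule extreme_point_of_convex_hull_affine_independent[OF C(1)])
  have v: "v \<in> C" using assms(2) vertex by blast
  have "S = {w - v | w. w \<in> C \<and> w \<noteq> v}"
    unfolding S_def edge_vectors_def vertex ..
  also have "\<dots> = (\<lambda>w. - v + w) ` (C - {v})"
    by (auto simp: image_iff)
  finally have S: "S = (+) (- v) ` (C - {v})" .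
  show ind: "independent S"
    using affine_dependent_iff_dependent2[OF v] C(1) by (simp add: S)
  show card: "card S = 3"
    unfolding S using C v by (subst card_image) (auto simp: card_Diff_singleton)
  have fin: "finite S" using card by (simp add: card_ge_0_finite)
  have sp: "span S = UNIV" by (rule span_three_independent[OF ind card])
  have "C = (+) v ` insert 0 S" using v by (auto simp: S image_image)
  then have "\<tau> = (+) v ` (convex hull insert 0 S)"
    unfolding \<tau> by (simp only: convex_hull_translation)
  also have "convex hull insert 0 S =
      {y. \<exists>u. (\<forall>x\<in>S. 0 \<le> u x) \<and> sum u S \<le> 1 \<and> (\<Sum>x\<in>S. u x *\<^sub>R x) = y}"
    using dependent_zero ind by (intro Starlike.simplex fin) auto
  also have "\<dots> = {y \<in> simplicial_cone S. (\<Sum>s\<in>S. representation S y s) \<le> 1}" (is "?L = ?R")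
  proof (intro equalityI subsetI)
    fix y assume "y \<in> ?L"
    then obtain u where u: "\<forall>x\<in>S. 0 \<le> u x" "sum u S \<le> 1" "y = (\<Sum>x\<in>S. u x *\<^sub>R x)"
      by auto
    have "representation S y s = u s" if "s \<in> S" for s
      using that ind sp fin unfolding u(3)
      by (simp add: representation_sum representation_scale representation_basis if_distrib cong: if_cong)
    then show "y \<in> ?R" using u by (simp add: simplicial_cone_def)
  next
    fix y assume "y \<in> ?R"
    moreover have "(\<Sum>s\<in>S. representation S y s *\<^sub>R s) = y"
      using ind sp fin by (intro real_vector.sum_representation_eq) auto
    ultimately show "y \<in> ?L"
      by (auto simp: simplicial_cone_def intro!: exI[of _ "representation S y"])
  qed
  finally show "\<tau> = (+) v ` {y \<in> simplicial_cone S. (\<Sum>s\<in>S. representation S y s) \<le> 1}" .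
qed

context
  fixes \<tau> :: "(real^3) set" and v :: "real^3"
  assumes tet: "3 simplex \<tau>" and apex: "v extreme_point_of \<tau>"
begin

lemma simplicial_coneI_scaled:
  assumes "v + t *\<^sub>R y \<in> \<tau>" "0 < t"
  shows "y \<in> simplicial_cone (edge_vectors \<tau> v)"
proof -
  let ?S = "edge_vectors \<tau> v"
  note \<tau> = simplex_in_edge_coordinates[OF tet apex]
  have "t *\<^sub>R y \<in> simplicial_cone ?S"
    using assms(1) by (subst (asm) \<tau>(3)) auto
  then show ?thesis
    using assms(2) \<tau>(1) span_three_independent[OF \<tau>(1,2)]
    by (auto simp: simplicial_cone_def representation_scale zero_le_mult_iff)
qed

lemma simplicial_cone_scaled_mem:
  assumes "y \<in> simplicial_cone (edge_vectors \<tau> v)"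
  shows "\<exists>e>0. \<forall>t. 0 \<le> t \<and> t \<le> e \<longrightarrow> v + t *\<^sub>R y \<in> \<tau>"
proof -
  let ?S = "edge_vectors \<tau> v"
  note \<tau> = simplex_in_edge_coordinates[OF tet apex]
  define m where "m = (\<Sum>s\<in>?S. representation ?S y s)"
  have m: "0 \<le> m"
    unfolding m_def using assms by (intro sum_nonneg) (auto simp: simplicial_cone_def)
  have "v + t *\<^sub>R y \<in> \<tau>" if t: "0 \<le> t" "t \<le> 1 / (1 + m)" for t
  proof -
    have rep: "representation ?S (t *\<^sub>R y) = (\<lambda>s. t * representation ?S y s)"
      using \<tau>(1) span_three_independent[OF \<tau>(1,2)] by (simp add: representation_scale)
    have "t * m \<le> 1 / (1 + m) * m" by (rule mult_right_mono[OF t(2) m])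
    also have "\<dots> \<le> 1" using m by (simp add: field_simps)
    finally have "t * m \<le> 1" .
    then have "(\<Sum>s\<in>?S. representation ?S (t *\<^sub>R y) s) \<le> 1"
      by (simp add: rep m_def flip: sum_distrib_left)
    moreover have "t *\<^sub>R y \<in> simplicial_cone ?S"
      using assms t(1) by (simp add: simplicial_cone_def rep)
    ultimately show ?thesis
      by (subst \<tau>(3)) blast
  qed
  then show ?thesis
    using m by (intro exI[of _ "1 / (1 + m)"]) auto
qed

text \<open>
  The solid angle is three times the volume of the cone over the directions from \<open>v\<close> into \<open>\<tau>\<close>, and
  these directions are exactly those of the simplicial cone, as every point of that cone can be
  scaled down into \<open>\<tau>\<close>.
\<close>
lemma solid_angle_eq_cone_measure:
  "solid_angle \<tau> v = 3 * measure lebesgue (simplicial_cone (edge_vectors \<tau> v) \<inter> cball 0 1)"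
proof -
  let ?S = "edge_vectors \<tau> v" and ?A = "(\<lambda>x. sgn (x - v)) ` (\<tau> - {v})"
  note \<tau> = simplex_in_edge_coordinates[OF tet apex]
  have "{r *\<^sub>R u | r u. 0 \<le> r \<and> r \<le> 1 \<and> u \<in> ?A} = simplicial_cone ?S \<inter> cball 0 1" (is "?L = ?R")
  proof (intro equalityI subsetI)
    fix y assume "y \<in> ?L"
    then obtain r x where r: "0 \<le> r" "r \<le> 1" and x: "x \<in> \<tau>" "x \<noteq> v" and y: "y = r *\<^sub>R sgn (x - v)"
      by auto
    have "norm y \<le> 1" using r x by (simp add: y norm_sgn)
    moreover have "y \<in> simplicial_cone ?S"
    proof -
      have "x - v \<in> simplicial_cone ?S"
        using simplicial_coneI_scaled[of 1 "x - v"] x by simp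
      then show ?thesis
        using r \<tau>(1) span_three_independent[OF \<tau>(1,2)]
        by (simp add: y sgn_div_norm simplicial_cone_def representation_scale)
    qed
    ultimately show "y \<in> ?R" by simp
  next
    fix y assume y: "y \<in> ?R"
    have nonzero: "\<exists>r u. z = r *\<^sub>R u \<and> 0 \<le> r \<and> r = norm z \<and> u \<in> ?A"
      if z: "z \<in> simplicial_cone ?S" "z \<noteq> 0" for z
    proof -
      obtain t where t: "t > 0" "v + t *\<^sub>R z \<in> \<tau>"
        using simplicial_cone_scaled_mem[OF z(1)] by (meson less_imp_le order_refl)
      have "sgn z = sgn ((v + t *\<^sub>R z) - v)"
        using t(1) by (simp add: sgn_scaleR)
      then have "sgn z \<in> ?A" using t z(2) by (intro image_eqI) auto
      moreover have "z = norm z *\<^sub>R sgn z" using z(2) by (simp add: sgn_div_norm)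
      ultimately show ?thesis by (metis norm_ge_zero)
    qed
    show "y \<in> ?L"
    proof (cases "y = 0")
      case True
      have "?S \<noteq> {}" using \<tau>(2) by auto
      then obtain s where "s \<in> ?S" by blast
      then have "s \<in> simplicial_cone ?S" "s \<noteq> 0"
        using \<tau>(1) dependent_zero by (auto simp: simplicial_cone_def representation_basis)
      then obtain u where "u \<in> ?A" using nonzero by blast
      then show ?thesis using True by (auto intro!: exI[of _ "0::real"])
    next
      case False
      then obtain r u where "y = r *\<^sub>R u" "0 \<le> r" "r = norm y" "u \<in> ?A"
        using nonzero[of y] y by blast
      then show ?thesis using y by (intro CollectI exI[of _ r] exI[of _ u]) simp
    qed
  qed
  then show ?thesis by (simp add: solid_angle_def sphere_area_def)
qed

text \<open>
  The sum of the edge vectors has all coordinates equal to \<open>1\<close>, so a small multiple of it is an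
  interior point of the cone in the unit ball.
\<close>
lemma solid_angle_pos: "0 < solid_angle \<tau> v"
proof -
  let ?S = "edge_vectors \<tau> v"
  note \<tau> = simplex_in_edge_coordinates[OF tet apex]
  have sp: "span ?S = UNIV" by (rule span_three_independent[OF \<tau>(1,2)])
  obtain n where n: "\<And>s. s \<in> ?S \<Longrightarrow> n s \<noteq> 0"
      "\<And>s x. s \<in> ?S \<Longrightarrow> representation ?S x s = n s \<bullet> x"
    using ex_coordinate_vectors[OF \<tau>(1) sp] by blast
  have fin: "finite ?S" using \<tau>(2) by (simp add: card_ge_0_finite)
  let ?O = "(\<Inter>s\<in>?S. {x. n s \<bullet> x > 0}) \<inter> ball 0 1"
  have "open ?O" using fin by (intro open_Int open_INT) (auto intro: open_halfspace_gt)
  moreover have "?O \<noteq> {}"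
  proof -
    define p where "p = \<Sum>?S"
    define t where "t = 1 / (1 + norm p)"
    have "n s \<bullet> p = 1" if "s \<in> ?S" for s
      using that n(2)[of s p, symmetric] \<tau>(1) sp fin
      by (simp add: p_def representation_sum representation_basis)
    moreover have "t > 0" by (simp add: t_def add_pos_nonneg)
    moreover have "norm (t *\<^sub>R p) = norm p / (1 + norm p)" by (simp add: t_def)
    then have "norm (t *\<^sub>R p) < 1" by (simp add: add_pos_nonneg)
    ultimately have "t *\<^sub>R p \<in> ?O" by simp
    then show ?thesis by blast
  qed
  ultimately have "\<not> negligible ?O" by (rule open_not_negligible)
  moreover have "?O \<subseteq> simplicial_cone ?S \<inter> cball 0 1"
    using n(2) by (auto simp: simplicial_cone_def less_imp_le)
  ultimately have "\<not> negligible (simplicial_cone ?S \<inter> cball 0 1)"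
    using negligible_subset by blast
  moreover have "simplicial_cone ?S \<inter> cball 0 1 \<in> lmeasurable"
    using closed_wedge[OF \<tau>(1) sp, of 0] \<tau>(1)
    by (simp add: simplicial_cone_eq_wedge_0 lmeasurable_compact closed_Int_compact)
  ultimately have "measure lebesgue (simplicial_cone ?S \<inter> cball 0 1) \<noteq> 0"
    by (simp add: negligible_iff_measure)
  then show ?thesis
    by (simp add: solid_angle_eq_cone_measure less_le)
qed

end

section \<open>Stars in a conforming mesh\<close>

text \<open>
  Conformity excludes hanging vertices: extreme points pass to the common face with a neighbouring
  tetrahedron, and from there to that tetrahedron.
\<close>
lemma mesh_vertex_extreme_point:
  assumes mesh: "conforming_tet_mesh \<T> D" and v: "v \<in> mesh_vertices \<T>" and \<tau>: "\<tau> \<in> star \<T> v"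
  shows "v extreme_point_of \<tau>"
proof -
  obtain \<tau>' where \<tau>': "\<tau>' \<in> \<T>" "v extreme_point_of \<tau>'"
    using v by (auto simp: mesh_vertices_def)
  show ?thesis
  proof (cases "\<tau> = \<tau>'")
    case False
    have v_in: "v \<in> \<tau> \<inter> \<tau>'"
      using \<tau> \<tau>'(2) by (auto simp: star_def extreme_point_of_def)
    then have "\<tau> \<inter> \<tau>' face_of \<tau>" "\<tau> \<inter> \<tau>' face_of \<tau>'"
      using mesh \<tau> \<tau>'(1) False unfolding conforming_tet_mesh_def star_def by blast+
    then show ?thesis using \<tau>'(2) v_in extreme_point_of_face by blast
  qed (use \<tau>' in simp)
qed

lemma finite_mesh_vertices:
  assumes "conforming_tet_mesh \<T> D"
  shows "finite (mesh_vertices \<T>)"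
proof -
  have "finite {v. v extreme_point_of \<tau>}" if "\<tau> \<in> \<T>" for \<tau>
  proof -
    have "3 simplex \<tau>" using assms that by (auto simp: conforming_tet_mesh_def)
    then show ?thesis
      by (simp add: finite_polyhedron_extreme_points polytope_imp_polyhedron simplex_imp_polytope)
  qed
  moreover have "mesh_vertices \<T> = (\<Union>\<tau>\<in>\<T>. {v. v extreme_point_of \<tau>})"
    by (auto simp: mesh_vertices_def)
  ultimately show ?thesis using assms by (auto simp: conforming_tet_mesh_def)
qed

text \<open>
  The cones cover the space because a small neighbourhood of \<open>v\<close> is covered by the mesh and avoids
  the finitely many closed tetrahedra that do not contain \<open>v\<close>. Two cones overlap in a null set
  because their intersection lies in the linear span of a common face of dimension at most \<open>2\<close>.
\<close>
lemma complete_simplicial_fan_at_interior_vertex: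
  assumes mesh: "conforming_tet_mesh \<T> D" and v: "v \<in> mesh_vertices \<T>" and int: "v \<in> interior D"
  shows "complete_simplicial_fan (star \<T> v) (\<lambda>\<tau>. edge_vectors \<tau> v)"
proof
  have finT: "finite \<T>" using mesh by (simp add: conforming_tet_mesh_def)
  then show "finite (star \<T> v)" by (simp add: star_def)
  have tet: "3 simplex \<tau>" if "\<tau> \<in> star \<T> v" for \<tau>
    using that mesh by (auto simp: conforming_tet_mesh_def star_def)
  note apex = mesh_vertex_extreme_point[OF mesh v]
  have faces: "\<tau> \<inter> \<tau>' face_of \<tau> \<and> \<tau> \<inter> \<tau>' face_of \<tau>' \<and> aff_dim (\<tau> \<inter> \<tau>') < 3"
    if "\<tau> \<in> star \<T> v" "\<tau>' \<in> star \<T> v" "\<tau> \<noteq> \<tau>'" for \<tau> \<tau>'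
  proof -
    have "\<tau> \<in> \<T>" "\<tau>' \<in> \<T>" "v \<in> \<tau> \<inter> \<tau>'" using that by (auto simp: star_def)
    then show ?thesis
      using mesh \<open>\<tau> \<noteq> \<tau>'\<close> unfolding conforming_tet_mesh_def by fastforce
  qed
  show "independent (edge_vectors \<tau> v)" "card (edge_vectors \<tau> v) = 3" if "\<tau> \<in> star \<T> v" for \<tau>
    using simplex_in_edge_coordinates[OF tet apex] that by auto
  show "(\<Union>\<tau>\<in>star \<T> v. simplicial_cone (edge_vectors \<tau> v)) = UNIV"
  proof -
    let ?U = "interior D - \<Union>{\<tau>\<in>\<T>. v \<notin> \<tau>}"
    have "closed (\<Union>{\<tau>\<in>\<T>. v \<notin> \<tau>})"
      using finT mesh
      by (intro closed_Union) (auto simp: conforming_tet_mesh_def intro: compact_imp_closed compact_simplex)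
    then have U: "open ?U" "v \<in> ?U" using int by auto
    have "\<exists>\<tau>\<in>star \<T> v. x \<in> simplicial_cone (edge_vectors \<tau> v)" for x
    proof -
      have "((\<lambda>t. v + t *\<^sub>R x) \<longlongrightarrow> v + 0 *\<^sub>R x) (at_right 0)"
        by (intro tendsto_intros)
      then have "eventually (\<lambda>t. v + t *\<^sub>R x \<in> ?U) (at_right 0)"
        using topological_tendstoD[OF _ U(1)] U(2) by auto
      then obtain t :: real where t: "t > 0" "v + t *\<^sub>R x \<in> ?U"
        by (metis (no_types, lifting) eventually_at_right_field field_lbound_gt_zero dense)
      then have "v + t *\<^sub>R x \<in> \<Union>\<T>"
        using mesh interior_subset[of D] by (auto simp: conforming_tet_mesh_def)
      then obtain \<tau> where "\<tau> \<in> \<T>" "v + t *\<^sub>R x \<in> \<tau>" by blast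
      then have "\<tau> \<in> star \<T> v" using t by (auto simp: star_def)
      then show ?thesis
        using simplicial_coneI_scaled[OF tet apex] \<open>v + t *\<^sub>R x \<in> \<tau>\<close> t(1) by blast
    qed
    then show ?thesis by blast
  qed
  show "negligible (simplicial_cone (edge_vectors \<tau> v) \<inter> simplicial_cone (edge_vectors \<tau>' v))"
    if \<tau>: "\<tau> \<in> star \<T> v" and \<tau>': "\<tau>' \<in> star \<T> v" and "\<tau> \<noteq> \<tau>'" for \<tau> \<tau>'
  proof (rule negligible_subset)
    (* As v lies in both tetrahedra, the affine hull of the translated face is a linear subspace. *)
    let ?F = "(+) (- v) ` (\<tau> \<inter> \<tau>')"
    have "0 \<in> ?F" using \<tau> \<tau>' by (auto simp: star_def intro: image_eqI[of _ _ v])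
    then have "int (dim ?F) = aff_dim ?F" by (simp add: aff_dim_zero hull_inc)
    also have "\<dots> = aff_dim (\<tau> \<inter> \<tau>')" by (rule aff_dim_translation_eq)
    also have "\<dots> < 3" using faces that by blast
    finally show "negligible (span ?F)" by (intro negligible_lowdim) simp
    show "simplicial_cone (edge_vectors \<tau> v) \<inter> simplicial_cone (edge_vectors \<tau>' v) \<subseteq> span ?F"
    proof
      fix x assume x: "x \<in> simplicial_cone (edge_vectors \<tau> v) \<inter> simplicial_cone (edge_vectors \<tau>' v)"
      obtain e where e: "e > 0" "\<And>t. 0 \<le> t \<and> t \<le> e \<Longrightarrow> v + t *\<^sub>R x \<in> \<tau>"
        using simplicial_cone_scaled_mem[OF tet[OF \<tau>] apex[OF \<tau>], of x] x by auto
      obtain e' where e': "e' > 0" "\<And>t. 0 \<le> t \<and> t \<le> e' \<Longrightarrow> v + t *\<^sub>R x \<in> \<tau>'"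
        using simplicial_cone_scaled_mem[OF tet[OF \<tau>'] apex[OF \<tau>'], of x] x by auto
      define t where "t = min e e'"
      have "t > 0" "v + t *\<^sub>R x \<in> \<tau> \<inter> \<tau>'" using e e' by (auto simp: t_def)
      then have "t *\<^sub>R x \<in> span ?F"
        by (intro span_base image_eqI[of _ _ "v + t *\<^sub>R x"]) auto
      then have "(1 / t) *\<^sub>R t *\<^sub>R x \<in> span ?F" by (rule span_mul)
      then show "x \<in> span ?F" using \<open>t > 0\<close> by simp
    qed
  qed
  show "a \<in> edge_vectors \<tau>' v"
    if \<tau>: "\<tau> \<in> star \<T> v" and \<tau>': "\<tau>' \<in> star \<T> v"
      and a: "a \<in> edge_vectors \<tau> v" and a': "a \<in> simplicial_cone (edge_vectors \<tau>' v)" for \<tau> \<tau>' a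
  proof (cases "\<tau> = \<tau>'")
    case False
    obtain w where w: "a = w - v" "w extreme_point_of \<tau>" "w \<noteq> v"
      using a by (auto simp: edge_vectors_def)
    obtain e where e: "e > 0" "\<And>t. 0 \<le> t \<and> t \<le> e \<Longrightarrow> v + t *\<^sub>R a \<in> \<tau>'"
      using simplicial_cone_scaled_mem[OF tet[OF \<tau>'] apex[OF \<tau>'] a'] by auto
    (* The factor 1/2 keeps the point strictly between v and w. *)
    define t where "t = min e (1 / 2)"
    have t: "0 < t" "t < 1" "v + t *\<^sub>R a \<in> \<tau>'" using e by (auto simp: t_def)
    have vw: "v \<in> \<tau>" "w \<in> \<tau>" using \<tau> w(2) by (auto simp: star_def extreme_point_of_def)
    (* A face that contains an inner point of the edge from v to w contains the endpoint w. *)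
    have seg: "v + t *\<^sub>R a \<in> open_segment v w"
      using t w by (auto simp: in_segment algebra_simps)
    have "convex \<tau>" using tet[OF \<tau>] by (simp add: convex_simplex)
    then have "v + t *\<^sub>R a \<in> \<tau>"
      using seg vw by (meson convex_contains_open_segment subsetD)
    then have "w \<in> \<tau>'"
      using faces[OF \<tau> \<tau>' False] seg vw t(3) unfolding face_of_def by blast
    then have "w extreme_point_of \<tau>'"
      using faces[OF \<tau> \<tau>' False] w(2) vw extreme_point_of_face by blast
    then show ?thesis using w by (auto simp: edge_vectors_def)
  qed (use a in simp)
qed

lemma edge_of_simplex_at_vertex:
  fixes \<tau> :: "'a::euclidean_space set"
  assumes "n simplex \<tau>" "v extreme_point_of \<tau>"
  shows "e edge_of \<tau> \<and> v \<in> e \<longleftrightarrow> (\<exists>a\<in>edge_vectors \<tau> v. e = closed_segment v (v + a))"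
proof -
  obtain C where C: "\<not> affine_dependent C" and \<tau>: "\<tau> = convex hull C"
    using assms(1) by (auto simp: simplex_def)
  have vertex: "w extreme_point_of \<tau> \<longleftrightarrow> w \<in> C" for w
    unfolding \<tau> by (rule extreme_point_of_convex_hull_affine_independent[OF C])
  have v: "v \<in> C" using assms(2) vertex by blast
  show ?thesis
  proof
    assume e: "e edge_of \<tau> \<and> v \<in> e"
    then obtain c where c: "c \<subseteq> C" "e = convex hull c"
      using face_of_convex_hull_affine_independent[OF C] by (auto simp: edge_of_def \<tau>)
    have ind: "\<not> affine_dependent c" using C c(1) affine_dependent_subset by blast
    have "card c = 2"
      using e c(2) aff_dim_affine_independent[OF ind] by (simp add: edge_of_def aff_dim_convex_hull)
    moreover have "v \<in> c"
    proof -
      have "v extreme_point_of e"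
        using e assms(2) extreme_point_of_face unfolding edge_of_def by blast
      then show ?thesis using c(2) extreme_point_of_convex_hull by blast
    qed
    ultimately obtain w where w: "c = {v, w}" "w \<noteq> v"
      by (metis card_2_iff insert_commute insertE singletonD)
    then have "w - v \<in> edge_vectors \<tau> v" using c(1) by (auto simp: edge_vectors_def vertex)
    moreover have "e = closed_segment v (v + (w - v))" by (simp add: c(2) w segment_convex_hull)
    ultimately show "\<exists>a\<in>edge_vectors \<tau> v. e = closed_segment v (v + a)" by blast
  next
    assume "\<exists>a\<in>edge_vectors \<tau> v. e = closed_segment v (v + a)"
    then obtain w where w: "w \<in> C" "w \<noteq> v" "e = closed_segment v w"
      by (auto simp: edge_vectors_def vertex)
    then have "e face_of \<tau>"
      using face_of_convex_hull_affine_independent[OF C] v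
      by (auto simp: \<tau> segment_convex_hull intro!: exI[of _ "{v, w}"])
    moreover have "aff_dim e = 1"
      using w(2) by (simp add: w(3) segment_convex_hull aff_dim_convex_hull aff_dim_2)
    ultimately show "e edge_of \<tau> \<and> v \<in> e" by (simp add: edge_of_def w(3))
  qed
qed

text \<open>
  An edge is determined by its vector at \<open>v\<close>, so an edge shared by several tetrahedra of the star is
  counted once on both sides.
\<close>
lemma card_edges_at:
  assumes mesh: "conforming_tet_mesh \<T> D" and v: "v \<in> mesh_vertices \<T>"
  shows "card (edges_at \<T> v) = card (\<Union>\<tau>\<in>star \<T> v. edge_vectors \<tau> v)"
proof -
  have tet: "3 simplex \<tau>" if "\<tau> \<in> star \<T> v" for \<tau>
    using that mesh by (auto simp: conforming_tet_mesh_def star_def)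
  note edges = edge_of_simplex_at_vertex[OF tet mesh_vertex_extreme_point[OF mesh v]]
  have mem: "v \<in> \<tau>" if "e edge_of \<tau>" "v \<in> e" for e \<tau>
    using that face_of_imp_subset unfolding edge_of_def by blast
  have "e \<in> edges_at \<T> v \<longleftrightarrow> (\<exists>\<tau>\<in>star \<T> v. e edge_of \<tau> \<and> v \<in> e)" for e
    using mem by (auto simp: edges_at_def mesh_edges_def star_def)
  then have "edges_at \<T> v = (\<Union>\<tau>\<in>star \<T> v. {e. e edge_of \<tau> \<and> v \<in> e})"
    by auto
  also have "\<dots> = (\<Union>\<tau>\<in>star \<T> v. (\<lambda>a. closed_segment v (v + a)) ` edge_vectors \<tau> v)"
    by (intro SUP_cong refl) (auto simp: edges)
  finally have "edges_at \<T> v = (\<lambda>a. closed_segment v (v + a)) ` (\<Union>\<tau>\<in>star \<T> v. edge_vectors \<tau> v)"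
    by (simp add: image_UN)
  moreover have "inj (\<lambda>a. closed_segment v (v + a))"
  proof (rule injI)
    fix a b assume "closed_segment v (v + a) = closed_segment v (v + b)"
    then have "{v, v + a} = {v, v + b}" by (simp only: closed_segment_eq)
    then show "a = b" by (auto simp: doubleton_eq_iff)
  qed
  ultimately show ?thesis by (simp add: card_image inj_on_subset)
qed

section \<open>The number of edges at an interior vertex\<close>

theorem lemma13:
  fixes \<Omega> :: "(real^3) set" and \<T> :: "(real^3) set set" and v :: "real^3"
  assumes "polytopal_domain \<Omega>"
    and "conforming_tet_mesh \<T> (closure \<Omega>)"
    and "v \<in> mesh_vertices \<T>"
    and "v \<notin> frontier \<Omega>"
  shows "real (card (edges_at \<T> v)) = 2 + 2 * pi / mean_solid_angle \<T> v \<and>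
         2 + 2 * pi / mean_solid_angle \<T> v \<le> 2 + 2 * pi / min_solid_angle \<T> v \<and>
         2 + 2 * pi / min_solid_angle \<T> v \<le> 2 + 2 * pi / mesh_min_solid_angle \<T>"
proof -
  note mesh = assms(2) and v = assms(3)
  have finT: "finite \<T>" using mesh by (simp add: conforming_tet_mesh_def)
  have fin: "finite (star \<T> w)" for w using finT by (simp add: star_def)
  have ne: "star \<T> w \<noteq> {}" if "w \<in> mesh_vertices \<T>" for w
    using that by (auto simp: mesh_vertices_def star_def extreme_point_of_def)
  have tet: "3 simplex \<tau>" if "\<tau> \<in> star \<T> w" for \<tau> w
    using that mesh by (auto simp: conforming_tet_mesh_def star_def)
  have "v \<in> closure \<Omega>"
    using mesh v by (auto simp: conforming_tet_mesh_def mesh_vertices_def extreme_point_of_def)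
  then have "v \<in> interior (closure \<Omega>)"
    using assms(4) interior_mono[OF closure_subset] by (auto simp: frontier_def)
  then interpret fan: complete_simplicial_fan "star \<T> v" "\<lambda>\<tau>. edge_vectors \<tau> v"
    by (rule complete_simplicial_fan_at_interior_vertex[OF mesh v])
  let ?t = "real (card (star \<T> v))"
  have t: "?t > 0" using fin ne[OF v] by (simp add: card_gt_0_iff)
  have "(\<Sum>\<tau>\<in>star \<T> v. solid_angle \<tau> v) =
      3 * (\<Sum>\<tau>\<in>star \<T> v. measure lebesgue (simplicial_cone (edge_vectors \<tau> v) \<inter> cball 0 1))"
    using solid_angle_eq_cone_measure[OF tet mesh_vertex_extreme_point[OF mesh v]]
    by (simp add: sum_distrib_left)
  also have "\<dots> = 4 * pi"
    by (simp add: fan.sum_cones content_cball unit_ball_vol_3)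
  finally have sum: "(\<Sum>\<tau>\<in>star \<T> v. solid_angle \<tau> v) = 4 * pi" .
  have edges: "real (card (edges_at \<T> v)) = 2 + ?t / 2"
    using fan.card_generators card_edges_at[OF mesh v] by simp
  have mean: "2 * pi / mean_solid_angle \<T> v = ?t / 2"
    using t by (simp add: mean_solid_angle_def sum)
  have min_pos: "0 < min_solid_angle \<T> w" if w: "w \<in> mesh_vertices \<T>" for w
    unfolding min_solid_angle_def
    using fin ne[OF w] solid_angle_pos[OF tet mesh_vertex_extreme_point[OF mesh w]] by simp
  have min_mean: "min_solid_angle \<T> v \<le> mean_solid_angle \<T> v"
  proof -
    have "?t * min_solid_angle \<T> v \<le> (\<Sum>\<tau>\<in>star \<T> v. solid_angle \<tau> v)"
      unfolding min_solid_angle_def using fin by (intro sum_bounded_below) auto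
    then show ?thesis using t by (simp add: mean_solid_angle_def field_simps)
  qed
  have mesh_min_pos: "0 < mesh_min_solid_angle \<T>"
    unfolding mesh_min_solid_angle_def
    using finite_mesh_vertices[OF mesh] v min_pos by (subst Min_gr_iff) auto
  have mesh_min: "mesh_min_solid_angle \<T> \<le> min_solid_angle \<T> v"
    unfolding mesh_min_solid_angle_def
    using finite_mesh_vertices[OF mesh] v by simp
  have "2 * pi / mean_solid_angle \<T> v \<le> 2 * pi / min_solid_angle \<T> v"
    using min_pos[OF v] min_mean by (intro frac_le) auto
  moreover have "2 * pi / min_solid_angle \<T> v \<le> 2 * pi / mesh_min_solid_angle \<T>"
    using mesh_min_pos mesh_min by (intro frac_le) auto
  ultimately show ?thesis
    using edges mean by simp
qed

end
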